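(* Let $\alpha=\alpha(n)=O(n)$, let $p=p(n)$ be admissible, and for each $n$ let $t=t_n$ be an $\alpha$-almost supermagic edge labeling of $K_n$. Then $$pn+o(pn)<R(p,t,n)<2pn+o(pn).$$
   Context: $K_n$ is the complete graph on $n$ vertices with edge set $E$, $\epsilon=\binom n2$, $[a]=\{1,\dots,a\}$. For a vertex $v$, $D(v)$ is the set of edges containing $v$. An edge labeling is a bijection $t:E\to[\epsilon]$; $s(t,v)=\sum_{e\in D(v)}t(e)$. $t$ is $\alpha$-almost supermagic if $|s(t,u)-s(t,v)|\le\alpha$ for all vertices $u,v$. A $p$-swap of $t$ is a map $\theta$ sending $t$ to another edge labeling $\theta t$ with $|t(e)-\theta t(e)|\le p$ for all $e$. $R(p,t,n)=\max_{\theta}\max_{u\ne v}|s(\theta t,u)-s(\theta t,v)|$ over all $p$-swaps $\theta$ of $t$. The magnitude $p=p(n)$ is admissible if $p(n)=o(n)$ and $p(n)\to\infty$ as $n\to\infty$. *)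

theory Defs
  imports Complex_Main "HOL-Library.Landau_Symbols"
begin

text \<open>The complete graph $K_n$ has vertex set $\{1,\dots,n\}$; an edge is a two-element set of
  vertices. Edge labelings are total functions on sets of naturals, but only their values on the
  edges of $K_n$ are ever used.\<close>

definition complete_edges :: "nat \<Rightarrow> nat set set" where
  "complete_edges n = {e. e \<subseteq> {1..n} \<and> card e = 2}"

definition incident_edges :: "nat \<Rightarrow> nat \<Rightarrow> nat set set" where
  "incident_edges n v = {e \<in> complete_edges n. v \<in> e}"

definition edge_labeling :: "nat \<Rightarrow> (nat set \<Rightarrow> nat) \<Rightarrow> bool" where
  "edge_labeling n t \<longleftrightarrow> bij_betw t (complete_edges n) {1..n choose 2}"

definition vertex_sum :: "nat \<Rightarrow> (nat set \<Rightarrow> nat) \<Rightarrow> nat \<Rightarrow> nat" where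
  "vertex_sum n t v = (\<Sum>e\<in>incident_edges n v. t e)"

definition almost_supermagic :: "nat \<Rightarrow> real \<Rightarrow> (nat set \<Rightarrow> nat) \<Rightarrow> bool" where
  "almost_supermagic n \<alpha> t \<longleftrightarrow>
     (\<forall>u\<in>{1..n}. \<forall>v\<in>{1..n}. \<bar>real (vertex_sum n t u) - real (vertex_sum n t v)\<bar> \<le> \<alpha>)"

text \<open>The identity counts as a \<open>p\<close>-swap for every \<open>p \<ge> 0\<close>.\<close>

definition p_swap ::
  "nat \<Rightarrow> real \<Rightarrow> (nat set \<Rightarrow> nat) \<Rightarrow> ((nat set \<Rightarrow> nat) \<Rightarrow> (nat set \<Rightarrow> nat)) \<Rightarrow> bool" where
  "p_swap n p t \<theta> \<longleftrightarrow>
     edge_labeling n (\<theta> t) \<and> (\<forall>e\<in>complete_edges n. \<bar>real (t e) - real (\<theta> t e)\<bar> \<le> p)"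

definition swap_differences :: "real \<Rightarrow> (nat set \<Rightarrow> nat) \<Rightarrow> nat \<Rightarrow> real set" where
  "swap_differences p t n =
     {\<bar>real (vertex_sum n (\<theta> t) u) - real (vertex_sum n (\<theta> t) v)\<bar> | \<theta> u v.
        p_swap n p t \<theta> \<and> u \<in> {1..n} \<and> v \<in> {1..n} \<and> u \<noteq> v}"

text \<open>The maximum is over a finite set by \<open>finite_swap_differences\<close>, which is nonempty when
  \<open>n \<ge> 2\<close> and \<open>p \<ge> 0\<close> by \<open>swap_differences_nonempty\<close>.\<close>

definition max_swap_difference :: "real \<Rightarrow> (nat set \<Rightarrow> nat) \<Rightarrow> nat \<Rightarrow> real" where
  "max_swap_difference p t n = Max (swap_differences p t n)"

definition admissible :: "(nat \<Rightarrow> real) \<Rightarrow> bool" where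
  "admissible p \<longleftrightarrow> p \<in> o(\<lambda>n. real n) \<and> filterlim p at_top sequentially"

lemma finite_complete_edges: "finite (complete_edges n)"
  by (rule finite_subset[of _ "Pow {1..n}"]) (auto simp: complete_edges_def)

lemma finite_swap_differences: "finite (swap_differences p t n)"
proof -
  let ?B = "card (complete_edges n) * (n choose 2)"
  have le: "vertex_sum n l v \<le> ?B" if "edge_labeling n l" for l v
  proof -
    have "vertex_sum n l v \<le> (\<Sum>e\<in>complete_edges n. l e)"
      unfolding vertex_sum_def
      by (rule sum_mono2) (auto simp: finite_complete_edges incident_edges_def)
    also have "\<dots> \<le> (\<Sum>e\<in>complete_edges n. n choose 2)"
      using that by (intro sum_mono) (auto simp: edge_labeling_def bij_betw_def)
    finally show ?thesis by simp
  qed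
  have "swap_differences p t n \<subseteq> (\<lambda>(a, b). \<bar>real a - real b\<bar>) ` ({..?B} \<times> {..?B})"
    using le by (fastforce simp: swap_differences_def p_swap_def)
  then show ?thesis by (rule finite_subset) simp
qed

lemma swap_differences_nonempty:
  assumes "edge_labeling n t" "n \<ge> 2" "p \<ge> 0"
  shows "swap_differences p t n \<noteq> {}"
proof -
  have "p_swap n p t id" using assms by (simp add: p_swap_def)
  moreover have "(1::nat) \<in> {1..n}" "2 \<in> {1..n}" "(1::nat) \<noteq> 2" using assms by auto
  ultimately show ?thesis unfolding swap_differences_def by blast
qed

end

(* Lower bound: group the labels into consecutive pairs, let w(x) be +1, -1 or 0 according to
   whether the edge labelled x contains only u, only v, or neither or both. Inside each pair, send
   the label of larger weight up and the other one down, both by about p. This is a bijection away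
   from the two ends, and it raises s(t,u) - s(t,v) by about p times the sum of |w(x) - w(x+1)| over
   the pairs. That sum is about 2n minus twice the number of pairs both of whose edges contain u, and
   likewise for v. Distinct edges share at most one vertex, so these numbers, summed over all
   vertices, are at most n(n-1)/4. Hence some u, v have total loss at most n-1, leaving a gain
   of about pn. Upper bound: each of the n-1 labels in a vertex sum moves by at most p. *)

theory Submission
  imports Defs
begin

section \<open>A bijection of labels that moves pairs up and down\<close>

text \<open>Labels are shifted to start at 0, and the pairs are \<open>{2 * i, 2 * i + 1}\<close> for \<open>i < K\<close>, with
  \<open>H\<close> true on exactly one member of each. At the two ends, where a pair \<open>m\<close> steps away does not
  exist, labels stay in their own pair and take the slots that nothing else moves into.\<close>

definition pair_shift :: "nat \<Rightarrow> nat \<Rightarrow> (nat \<Rightarrow> bool) \<Rightarrow> nat \<Rightarrow> nat" where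
  "pair_shift m K H x =
     (let i = x div 2 in
      if K \<le> i then x
      else if H x then (if i + m < K then 2 * (i + m) + 1 else 2 * i)
      else (if m \<le> i then 2 * (i - m) else 2 * i + 1))"

lemma pair_shift_outside: "2 * K \<le> x \<Longrightarrow> pair_shift m K H x = x"
proof -
  assume "2 * K \<le> x"
  then have "K \<le> x div 2" by simp
  then show ?thesis by (simp add: pair_shift_def)
qed

lemma pair_shift_bounded: "pair_shift m K H x < 2 * K \<longleftrightarrow> x < 2 * K"
proof -
  have "x < 2 * K \<longleftrightarrow> \<not> K \<le> x div 2" by auto
  then show ?thesis by (auto simp: pair_shift_def Let_def)
qed

text \<open>The image reveals the pair and the mark. Odd slots of pairs \<open>i >= m\<close>
  receive marked labels moving up, odd slots below \<open>m\<close> the unmarked ones that stay.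
  Even slots of pairs with \<open>i + m < K\<close> receive unmarked labels moving down, the
  remaining even slots the marked ones that stay. As the mark separates the two members of a pair,
  the label is determined.\<close>

lemma inj_pair_shift:
  assumes H: "\<And>i. i < K \<Longrightarrow> H (2 * i) \<noteq> H (2 * i + 1)"
  shows "inj (pair_shift m K H)"
proof (rule injI)
  fix x y assume eq: "pair_shift m K H x = pair_shift m K H y"
  show "x = y"
  proof (cases "x < 2 * K")
    case False
    then show ?thesis using eq pair_shift_bounded[of m K H] pair_shift_outside[of K]
      by (metis not_le)
  next
    case True
    then have y: "y < 2 * K" using eq pair_shift_bounded[of m K H] by metis
    have i: "\<not> K \<le> x div 2" "\<not> K \<le> y div 2" using True y by auto
    have *: "x div 2 = y div 2 \<and> H x = H y"
    proof -
      have odd: "Suc (2 * a) \<noteq> 2 * b" "Suc (2 * a + 2 * c) \<noteq> 2 * b" for a b c :: nat by presburger+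
      show ?thesis
        using eq i unfolding pair_shift_def Let_def
        by (cases "H x"; cases "H y"; simp add: odd odd[symmetric] eq_diff_iff split: if_splits)
    qed
    have half: "z = 2 * (z div 2) \<or> z = 2 * (z div 2) + 1" for z :: nat by presburger
    show ?thesis
      using H[of "x div 2"] * i half[of x] half[of y] by (metis not_le)
  qed
qed

lemma bij_betw_pair_shift:
  assumes "\<And>i. i < N div 2 \<Longrightarrow> H (2 * i) \<noteq> H (2 * i + 1)"
  shows "bij_betw (pair_shift m (N div 2) H) {..<N} {..<N}"
proof -
  let ?f = "pair_shift m (N div 2) H"
  have "inj_on ?f {..<N}" using inj_pair_shift[OF assms] by (rule inj_on_subset) auto
  moreover have "?f ` {..<N} \<subseteq> {..<N}"
  proof safe
    fix x assume "x < N"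
    then show "?f x < N"
      using pair_shift_bounded[of m "N div 2" H x] pair_shift_outside[of "N div 2" x m H]
      by (cases "x < 2 * (N div 2)") auto
  qed
  ultimately show ?thesis by (simp add: bij_betw_def endo_inj_surj)
qed

text \<open>Moving by at most \<open>m\<close> pairs costs \<open>2 * m\<close>; the extra 1 is a
  possible change of position inside the pair.\<close>

lemma pair_shift_displacement: "\<bar>real (pair_shift m K H x) - real x\<bar> \<le> 2 * real m + 1"
proof -
  have "2 * (x div 2) \<le> x" "x \<le> 2 * (x div 2) + 1" by simp_all
  then have "pair_shift m K H x \<le> x + (2 * m + 1)" "x \<le> pair_shift m K H x + (2 * m + 1)"
    unfolding pair_shift_def Let_def by (simp_all split: if_split) linarith+
  then show ?thesis by linarith
qed

section \<open>The weighted gain of the shift\<close>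

lemma sum_lessThan_pairs:
  fixes f :: "nat \<Rightarrow> real"
  shows "(\<Sum>x<2 * K. f x) = (\<Sum>i<K. f (2 * i) + f (2 * i + 1))"
  by (induction K) (auto simp: algebra_simps)

lemma sum_lessThan_div2:
  fixes f :: "nat \<Rightarrow> real"
  shows "(\<Sum>x<N. f x) = (\<Sum>i<N div 2. f (2 * i) + f (2 * i + 1)) + (if odd N then f (N - 1) else 0)"
proof (cases "even N")
  case True
  then show ?thesis using sum_lessThan_pairs[of f "N div 2"] by auto
next
  case False
  then obtain k where "N = 2 * k + 1" by (rule oddE)
  then show ?thesis using sum_lessThan_pairs[of f k] by simp
qed

text \<open>In \<open>\<bar>a\<bar> * (D + 1)\<close> only the part with \<open>D\<close> is
  estimated by \<open>\<bar>a\<bar> \<le> 1\<close>. The extra unit stays charged to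
  \<open>\<bar>a\<bar>\<close>, so that it sums to the total weight.\<close>

lemma weight_shift_bound:
  fixes a d D :: real
  assumes "\<bar>a\<bar> \<le> 1" "\<bar>d\<bar> \<le> D + 1" "0 \<le> D"
  shows "a * d \<ge> - \<bar>a\<bar> - D"
proof -
  have "\<bar>a * d\<bar> \<le> \<bar>a\<bar> * (D + 1)" unfolding abs_mult using assms by (intro mult_left_mono) auto
  also have "\<dots> = \<bar>a\<bar> * D + \<bar>a\<bar>" by (simp add: algebra_simps)
  also have "\<bar>a\<bar> * D \<le> 1 * D" using assms by (intro mult_right_mono) auto
  finally show ?thesis by linarith
qed

text \<open>A pair away from the ends gains at least \<open>2 * m\<close> times its weight
  difference. Only the at most \<open>2 * m\<close> pairs near the ends can fall short, each by at
  most \<open>8 * m\<close> plus its own absolute weights; this gives the two error terms.\<close>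

lemma weighted_displacement:
  fixes w :: "nat \<Rightarrow> real"
  assumes w: "\<And>x. \<bar>w x\<bar> \<le> 1"
  shows "\<exists>\<pi>. bij_betw \<pi> {..<N} {..<N} \<and> (\<forall>x. \<bar>real (\<pi> x) - real x\<bar> \<le> 2 * real m + 1) \<and>
    (\<Sum>x<N. w x * (real (\<pi> x) - real x)) \<ge>
      2 * real m * (\<Sum>i<N div 2. \<bar>w (2 * i) - w (2 * i + 1)\<bar>) - (\<Sum>x<N. \<bar>w x\<bar>) - 16 * (real m)\<^sup>2"
proof -
  let ?K = "N div 2"
  \<comment> \<open>The heavier member is marked to move up; on a tie it is the odd one, so exactly
    one member is always marked.\<close>
  define H where "H x = (if even x then w x > w (x + 1) else \<not> w (x - 1) > w x)" for x
  have H: "H (2 * i) \<noteq> H (2 * i + 1)" for i by (simp add: H_def)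
  define \<pi> where "\<pi> = pair_shift m ?K H"
  define c where "c x = w x * (real (\<pi> x) - real x)" for x
  define B where "B = {i. i < ?K \<and> \<not> (m \<le> i \<and> i + m < ?K)}"
  have disp: "\<bar>real (\<pi> x) - real x\<bar> \<le> 2 * real m + 1" for x
    unfolding \<pi>_def by (rule pair_shift_displacement)
  have pair: "c (2 * i) + c (2 * i + 1) \<ge> 2 * real m * \<bar>w (2 * i) - w (2 * i + 1)\<bar>
      - (\<bar>w (2 * i)\<bar> + \<bar>w (2 * i + 1)\<bar>) - (if i \<in> B then 8 * real m else 0)"
    if i: "i < ?K" for i
  proof -
    let ?a = "w (2 * i)" and ?b = "w (2 * i + 1)"
    show ?thesis
    proof (cases "i \<in> B")
      \<comment> \<open>Near an end the two members may lose \<open>4 * m\<close> together, and the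
        promised gain is at most another \<open>4 * m\<close>.\<close>
      case True
      have 1: "c (2 * i) \<ge> - \<bar>?a\<bar> - 2 * real m" "c (2 * i + 1) \<ge> - \<bar>?b\<bar> - 2 * real m"
        unfolding c_def
        by (rule weight_shift_bound[OF w disp]; simp)+
      have "2 * real m * \<bar>?a - ?b\<bar> \<le> 2 * real m * 2"
        using w[of "2 * i"] w[of "2 * i + 1"] by (intro mult_left_mono) auto
      then show ?thesis using True 1 by simp
    next
      case False
      then have im: "m \<le> i" "i + m < ?K" using i by (auto simp: B_def)
      have d: "(2 * i + 1) div 2 = i" by simp
      show ?thesis
      proof (cases "?a > ?b")
        case True
        \<comment> \<open>Here the members also swap positions, so both move by
          \<open>2 * m + 1\<close>; if the odd member is marked, both move by exactly
          \<open>2 * m\<close>.\<close>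
        have "\<pi> (2 * i) = 2 * (i + m) + 1" "\<pi> (2 * i + 1) = 2 * (i - m)"
          using im i True unfolding \<pi>_def pair_shift_def Let_def d by (simp_all add: H_def)
        then have "c (2 * i) = ?a * (2 * real m + 1)" "c (2 * i + 1) = ?b * (- 2 * real m - 1)"
          using im by (simp_all add: c_def of_nat_diff)
        then show ?thesis using False True by (simp add: algebra_simps)
      next
        case False2: False
        have "\<pi> (2 * i) = 2 * (i - m)" "\<pi> (2 * i + 1) = 2 * (i + m) + 1"
          using im i False2 unfolding \<pi>_def pair_shift_def Let_def d by (simp_all add: H_def)
        then have "c (2 * i) = ?a * (- 2 * real m)" "c (2 * i + 1) = ?b * (2 * real m)"
          using im by (simp_all add: c_def of_nat_diff)
        then show ?thesis using False False2 by (simp add: algebra_simps)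
      qed
    qed
  qed
  have "card B \<le> card ({..<m} \<union> {?K - m..<?K})"
    by (intro card_mono) (auto simp: B_def)
  also have "\<dots> \<le> 2 * m" by (rule order_trans[OF card_Un_le]) auto
  finally have B: "real (card B) \<le> 2 * real m" by linarith
  \<comment> \<open>For odd \<open>N\<close> the last label has no partner and stays fixed.\<close>
  have tail: "odd N \<Longrightarrow> c (N - 1) = 0"
  proof -
    assume "odd N"
    then have "2 * ?K \<le> N - 1" by simp
    then show ?thesis by (simp add: c_def \<pi>_def pair_shift_outside)
  qed
  have "(\<Sum>i<?K. if i \<in> B then 8 * real m else 0) = (\<Sum>i\<in>{..<?K} \<inter> B. 8 * real m)"
    by (subst sum.inter_restrict) auto
  also have "{..<?K} \<inter> B = B" by (auto simp: B_def)
  also have "(\<Sum>i\<in>B. 8 * real m) \<le> 2 * real m * (8 * real m)"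
    using mult_right_mono[OF B, of "8 * real m"] by simp
  finally have boundary: "(\<Sum>i<?K. if i \<in> B then 8 * real m else 0) \<le> 16 * (real m)\<^sup>2"
    by (simp add: power2_eq_square)
  have "(\<Sum>x<N. c x) = (\<Sum>i<?K. c (2 * i) + c (2 * i + 1))"
    using tail sum_lessThan_div2[of c N] by simp
  also have "\<dots> \<ge> (\<Sum>i<?K. 2 * real m * \<bar>w (2 * i) - w (2 * i + 1)\<bar>
      - (\<bar>w (2 * i)\<bar> + \<bar>w (2 * i + 1)\<bar>) - (if i \<in> B then 8 * real m else 0))"
    using pair by (intro sum_mono) auto
  finally have "(\<Sum>x<N. c x) \<ge> 2 * real m * (\<Sum>i<?K. \<bar>w (2 * i) - w (2 * i + 1)\<bar>)
      - (\<Sum>i<?K. \<bar>w (2 * i)\<bar> + \<bar>w (2 * i + 1)\<bar>) - (\<Sum>i<?K. if i \<in> B then 8 * real m else 0)"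
    by (simp only: sum_subtractf sum_distrib_left)
  moreover have "(\<Sum>i<?K. \<bar>w (2 * i)\<bar> + \<bar>w (2 * i + 1)\<bar>) \<le> (\<Sum>x<N. \<bar>w x\<bar>)"
    using sum_lessThan_div2[of "\<lambda>x. \<bar>w x\<bar>" N] by simp
  ultimately have "(\<Sum>x<N. c x) \<ge> 2 * real m * (\<Sum>i<?K. \<bar>w (2 * i) - w (2 * i + 1)\<bar>)
      - (\<Sum>x<N. \<bar>w x\<bar>) - 16 * (real m)\<^sup>2"
    using boundary by linarith
  moreover have "bij_betw \<pi> {..<N} {..<N}"
    unfolding \<pi>_def using H by (rule bij_betw_pair_shift)
  ultimately show ?thesis using disp unfolding c_def by (intro exI[of _ \<pi>] conjI allI)
qed

section \<open>Counting edges and averaging over vertices\<close>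

lemma card_incident_edges:
  assumes "u \<in> {1..n}"
  shows "card (incident_edges n u) = n - 1"
proof -
  have "bij_betw (\<lambda>v. {u, v}) ({1..n} - {u}) (incident_edges n u)"
  proof (rule bij_betw_imageI)
    show "inj_on (\<lambda>v. {u, v}) ({1..n} - {u})" by (auto simp: inj_on_def doubleton_eq_iff)
    show "(\<lambda>v. {u, v}) ` ({1..n} - {u}) = incident_edges n u"
      using assms by (auto simp: incident_edges_def complete_edges_def card_2_iff)
  qed
  then show ?thesis using assms by (metis bij_betw_same_card card_Diff_singleton card_atLeastAtMost diff_Suc_1)
qed

text \<open>Summing over all edges lets the difference of two vertex sums become one weighted
  sum.\<close>

lemma vertex_sum_complete_edges:
  "real (vertex_sum n l u) = (\<Sum>e\<in>complete_edges n. of_bool (u \<in> e) * real (l e))"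
proof -
  have "real (vertex_sum n l u) = (\<Sum>e\<in>complete_edges n \<inter> {e. u \<in> e}. real (l e))"
    by (simp add: vertex_sum_def incident_edges_def Int_def)
  also have "\<dots> = (\<Sum>e\<in>complete_edges n. if u \<in> e then real (l e) else 0)"
    by (simp add: sum.inter_restrict finite_complete_edges)
  also have "\<dots> = (\<Sum>e\<in>complete_edges n. of_bool (u \<in> e) * real (l e))"
    by (intro sum.cong) auto
  finally show ?thesis .
qed

text \<open>The constant labeling 1 turns the vertex sum into the degree.\<close>

lemma sum_of_bool_complete_edges:
  assumes "u \<in> {1..n}"
  shows "(\<Sum>e\<in>complete_edges n. of_bool (u \<in> e)) = real (n - 1)"
  using vertex_sum_complete_edges[of n "\<lambda>_. 1" u] card_incident_edges[OF assms]
  by (simp add: vertex_sum_def)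

lemma common_vertices_le_1:
  assumes "e \<in> complete_edges n" "e' \<in> complete_edges n" "e \<noteq> e'"
  shows "card (e \<inter> e') \<le> 1"
proof (rule ccontr)
  assume "\<not> ?thesis"
  then have c: "card (e \<inter> e') \<ge> 2" by simp
  have f: "card e = 2" "card e' = 2" "finite e" "finite e'"
    using assms by (auto simp: complete_edges_def intro: card_ge_0_finite)
  have "e \<inter> e' = e" "e \<inter> e' = e'" using c f by (intro card_seteq; simp)+
  then show False using assms by auto
qed

text \<open>Averaging over ordered pairs of distinct elements: each \<open>l u\<close> occurs
  \<open>2 * (card S - 1)\<close> times among \<open>card S * (card S - 1)\<close> pairs.\<close>

lemma exists_small_pair:
  fixes l :: "'a \<Rightarrow> real"
  assumes S: "finite S" "card S \<ge> 2" and sum: "(\<Sum>u\<in>S. l u) * 2 \<le> real (card S) * c"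
  shows "\<exists>u\<in>S. \<exists>v\<in>S. u \<noteq> v \<and> l u + l v \<le> c"
proof (rule ccontr)
  assume "\<not> ?thesis"
  then have *: "c < l u + l v" if "u \<in> S" "v \<in> S - {u}" for u v using that by force
  let ?s = "real (card S)" and ?L = "\<Sum>u\<in>S. l u"
  have "(\<Sum>u\<in>S. \<Sum>v\<in>S - {u}. c) < (\<Sum>u\<in>S. \<Sum>v\<in>S - {u}. l u + l v)"
  proof (rule sum_strict_mono)
    fix u assume u: "u \<in> S"
    then have "card (S - {u}) > 0" using S by simp
    then have "S - {u} \<noteq> {}" by (metis card.empty less_irrefl)
    then show "(\<Sum>v\<in>S - {u}. c) < (\<Sum>v\<in>S - {u}. l u + l v)"
      using S * u by (intro sum_strict_mono) auto
  qed (use S in auto)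
  also have "\<dots> = (\<Sum>u\<in>S. (?s - 1) * l u + (?L - l u))"
    using S by (intro sum.cong) (auto simp: sum.distrib sum_diff1 of_nat_diff)
  also have "\<dots> = (?s - 1) * ?L + ?s * ?L - ?L"
    by (simp add: sum.distrib sum_subtractf flip: sum_distrib_left)
  also have "\<dots> = (?s - 1) * (?L * 2)" by (simp add: algebra_simps)
  also have "\<dots> \<le> (?s - 1) * (?s * c)" using S sum by (intro mult_left_mono) auto
  also have "\<dots> = (\<Sum>u\<in>S. \<Sum>v\<in>S - {u}. c)"
    using S by (simp add: of_nat_diff)
  finally show False by simp
qed

section \<open>A swap that separates two well-chosen vertices\<close>

lemma sum_of_bool_card:
  "finite A \<Longrightarrow> (\<Sum>x\<in>A. of_bool (P x)) = real (card {x \<in> A. P x})"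
  by (simp add: Int_def)

text \<open>The change of the difference is bounded, not the difference itself, because it is linear
  in the displacements of the labels; how close the sums under \<open>t\<close> are enters
  later.\<close>

lemma exists_swap_increasing_difference:
  assumes lab: "edge_labeling n t" and n: "n \<ge> 2"
  shows "\<exists>\<theta> u v. p_swap n (2 * real m + 1) t \<theta> \<and> u \<in> {1..n} \<and> v \<in> {1..n} \<and> u \<noteq> v \<and>
    (real (vertex_sum n (\<theta> t) u) - real (vertex_sum n (\<theta> t) v))
      - (real (vertex_sum n t u) - real (vertex_sum n t v))
    \<ge> 2 * real m * (real n - 4) - 2 * real n - 16 * (real m)\<^sup>2"
proof -
  define N where "N = n choose 2"
  let ?K = "N div 2" and ?E = "complete_edges n"
  have t: "bij_betw t ?E {1..N}" using lab by (simp add: edge_labeling_def N_def)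
  have pred: "bij_betw (\<lambda>x. x - 1) {1..N} {..<N}"
    by (rule bij_betw_byWitness[where f' = Suc]) auto
  have t0: "bij_betw (\<lambda>e. t e - 1) ?E {..<N}"
    using bij_betw_trans[OF t pred] by (simp add: o_def)
  define E where "E = inv_into ?E (\<lambda>e. t e - 1)"
  have E: "bij_betw E {..<N} ?E" unfolding E_def using t0 by (rule bij_betw_inv_into)
  have tE: "t (E x) - 1 = x" if "x < N" for x
    unfolding E_def using bij_betw_inv_into_right[OF t0, of x] that by simp
  have t_pos: "t e \<ge> 1" if "e \<in> ?E" for e using t that by (auto simp: bij_betw_def)
  have E_mem: "E x \<in> ?E" if "x < N" for x using E that by (auto simp: bij_betw_def)

  \<comment> \<open>The loss at \<open>u\<close>: the number of label pairs both of whose edges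
    contain \<open>u\<close>.\<close>
  define l where "l u = (\<Sum>i<?K. of_bool (u \<in> E (2 * i) \<inter> E (2 * i + 1)) :: real)" for u
  have "(\<Sum>u\<in>{1..n}. l u) = (\<Sum>i<?K. \<Sum>u\<in>{1..n}. of_bool (u \<in> E (2 * i) \<inter> E (2 * i + 1)))"
    unfolding l_def by (rule sum.swap)
  also have "\<dots> \<le> (\<Sum>i<?K. 1)"
  proof (rule sum_mono)
    fix i assume i: "i \<in> {..<?K}"
    then have x: "2 * i < N" "2 * i + 1 < N" by auto
    have "E (2 * i) \<noteq> E (2 * i + 1)" using tE[OF x(1)] tE[OF x(2)] by auto
    then have "card (E (2 * i) \<inter> E (2 * i + 1)) \<le> 1"
      using x E_mem by (intro common_vertices_le_1) auto
    moreover have "{u \<in> {1..n}. u \<in> E (2 * i) \<inter> E (2 * i + 1)} = E (2 * i) \<inter> E (2 * i + 1)"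
      using E_mem[OF x(1)] by (auto simp: complete_edges_def)
    ultimately show "(\<Sum>u\<in>{1..n}. of_bool (u \<in> E (2 * i) \<inter> E (2 * i + 1))) \<le> (1 :: real)"
      by (subst sum_of_bool_card) auto
  qed
  finally have "(\<Sum>u\<in>{1..n}. l u) * 2 \<le> real (2 * ?K)" by simp
  also have "\<dots> \<le> real N" by (rule of_nat_mono) simp
  \<comment> \<open>Since \<open>N\<close> is \<open>n * (n - 1) / 2\<close>, the average makes the
    losses at some two vertices total at most \<open>(n - 1) / 2\<close>.\<close>
  also have "\<dots> = real (card {1..n}) * ((real n - 1) / 2)"
    using n by (simp add: N_def choose_two real_of_nat_div of_nat_diff)
  finally obtain u v where uv: "u \<in> {1..n}" "v \<in> {1..n}" "u \<noteq> v" and l: "l u + l v \<le> (real n - 1) / 2"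
    using exists_small_pair[of "{1..n}" l "(real n - 1) / 2"] n by auto

  define W where "W e = of_bool (u \<in> e) - (of_bool (v \<in> e) :: real)" for e
  \<comment> \<open>For \<open>x \<ge> N\<close> the edge \<open>E x\<close> is unspecified, but
    \<open>W\<close> is bounded by 1 on every set, so the bound on \<open>w\<close> holds for all
    \<open>x\<close>.\<close>
  define w where "w x = W (E x)" for x
  have w_le_1: "\<bar>w x\<bar> \<le> 1" for x by (simp add: w_def W_def of_bool_def)
  from weighted_displacement[of w N m, OF w_le_1] obtain \<pi> where
    \<pi>: "bij_betw \<pi> {..<N} {..<N}" and disp: "\<And>x. \<bar>real (\<pi> x) - real x\<bar> \<le> 2 * real m + 1" and
    gain: "(\<Sum>x<N. w x * (real (\<pi> x) - real x)) \<ge>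
      2 * real m * (\<Sum>i<?K. \<bar>w (2 * i) - w (2 * i + 1)\<bar>) - (\<Sum>x<N. \<bar>w x\<bar>) - 16 * (real m)\<^sup>2"
    by blast

  define t' where "t' e = Suc (\<pi> (t e - 1))" for e
  have "bij_betw Suc {..<N} {1..N}" by (rule bij_betw_byWitness[where f' = "\<lambda>x. x - 1"]) auto
  then have lab': "bij_betw t' ?E {1..N}"
    using bij_betw_trans[OF bij_betw_trans[OF t0 \<pi>], of Suc "{1..N}"]
    by (simp add: o_def t'_def[abs_def])
  have shift: "real (t' e) - real (t e) = real (\<pi> (t e - 1)) - real (t e - 1)" if "e \<in> ?E" for e
    using t_pos[OF that] by (simp add: t'_def of_nat_diff)
  have "\<bar>real (t e) - real (t' e)\<bar> \<le> 2 * real m + 1" if "e \<in> ?E" for e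
    using disp[of "t e - 1"] shift[OF that] by linarith
  \<comment> \<open>A constant map suffices as the swap, since only its value at \<open>t\<close>
    matters.\<close>
  then have swap: "p_swap n (2 * real m + 1) t (\<lambda>_. t')"
    using lab' by (simp add: p_swap_def edge_labeling_def N_def)

  have difference: "real (vertex_sum n k u) - real (vertex_sum n k v) = (\<Sum>e\<in>?E. W e * real (k e))" for k
    unfolding vertex_sum_complete_edges W_def by (simp add: left_diff_distrib sum_subtractf)
  have "(real (vertex_sum n t' u) - real (vertex_sum n t' v))
      - (real (vertex_sum n t u) - real (vertex_sum n t v)) = (\<Sum>e\<in>?E. W e * (real (t' e) - real (t e)))"
    unfolding difference by (simp add: right_diff_distrib sum_subtractf)
  also have "\<dots> = (\<Sum>e\<in>?E. W e * (real (\<pi> (t e - 1)) - real (t e - 1)))"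
    using shift by (intro sum.cong) auto
  also have "\<dots> = (\<Sum>x<N. W (E x) * (real (\<pi> (t (E x) - 1)) - real (t (E x) - 1)))"
    by (rule sum.reindex_bij_betw[OF E, symmetric])
  also have "\<dots> = (\<Sum>x<N. w x * (real (\<pi> x) - real x))"
    using tE by (intro sum.cong) (auto simp: w_def)
  finally have change: "(real (vertex_sum n t' u) - real (vertex_sum n t' v))
      - (real (vertex_sum n t u) - real (vertex_sum n t v)) = (\<Sum>x<N. w x * (real (\<pi> x) - real x))" .

  \<comment> \<open>The edge \<open>{u, v}\<close> has weight 0 but is counted in both degrees,
    hence the correction by 2 below.\<close>
  have uv_edge: "e = {u, v} \<longleftrightarrow> u \<in> e \<and> v \<in> e" if "e \<in> ?E" for e
  proof
    assume "u \<in> e \<and> v \<in> e"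
    then have "{u, v} = e"
      using that uv(3) by (intro card_seteq) (auto simp: complete_edges_def intro: card_ge_0_finite)
    then show "e = {u, v}" by simp
  qed simp
  have "?E \<inter> {e. e = {u, v}} = {{u, v}}"
    using uv by (auto simp: complete_edges_def)
  then have one: "(\<Sum>e\<in>?E. of_bool (e = {u, v})) = (1 :: real)"
    by (simp add: finite_complete_edges)
  have "(\<Sum>x<N. \<bar>w x\<bar>) = (\<Sum>e\<in>?E. \<bar>W e\<bar>)"
    unfolding w_def by (rule sum.reindex_bij_betw[OF E])
  also have "\<dots> = (\<Sum>e\<in>?E. of_bool (u \<in> e) + of_bool (v \<in> e) - 2 * of_bool (e = {u, v}))"
  proof (rule sum.cong)
    fix e assume "e \<in> ?E"
    then show "\<bar>W e\<bar> = of_bool (u \<in> e) + of_bool (v \<in> e) - 2 * of_bool (e = {u, v})"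
      unfolding W_def uv_edge[OF \<open>e \<in> ?E\<close>] by (cases "u \<in> e"; cases "v \<in> e") simp_all
  qed simp
  also have "\<dots> = real (n - 1) + real (n - 1) - 2 * 1"
    unfolding sum_subtractf sum.distrib sum_distrib_left[symmetric]
      sum_of_bool_complete_edges[OF uv(1)] sum_of_bool_complete_edges[OF uv(2)] one ..
  finally have abs_w: "(\<Sum>x<N. \<bar>w x\<bar>) = 2 * real n - 4" using n by (simp add: of_nat_diff)

  \<comment> \<open>The 1 pays for the unpaired last label when \<open>N\<close> is odd.\<close>
  have "(\<Sum>x<N. \<bar>w x\<bar>) - 1 \<le> (\<Sum>i<?K. \<bar>w (2 * i)\<bar> + \<bar>w (2 * i + 1)\<bar>)"
    using sum_lessThan_div2[of "\<lambda>x. \<bar>w x\<bar>" N] w_le_1[of "N - 1"] by (cases "odd N") auto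
  \<comment> \<open>Only two equal nonzero weights cancel in a difference; then both edges contain
    \<open>u\<close>, or both contain \<open>v\<close>.\<close>
  moreover have "(\<Sum>i<?K. \<bar>w (2 * i)\<bar> + \<bar>w (2 * i + 1)\<bar>) - 2 * l u - 2 * l v
      \<le> (\<Sum>i<?K. \<bar>w (2 * i) - w (2 * i + 1)\<bar>)"
    unfolding l_def sum_distrib_left sum_subtractf[symmetric]
  proof (rule sum_mono)
    fix i
    show "\<bar>w (2 * i)\<bar> + \<bar>w (2 * i + 1)\<bar> - 2 * of_bool (u \<in> E (2 * i) \<inter> E (2 * i + 1))
        - 2 * of_bool (v \<in> E (2 * i) \<inter> E (2 * i + 1)) \<le> \<bar>w (2 * i) - w (2 * i + 1)\<bar>"
      unfolding w_def W_def
      by (cases "u \<in> E (2 * i)"; cases "v \<in> E (2 * i)"; cases "u \<in> E (2 * i + 1)";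
          cases "v \<in> E (2 * i + 1)") simp_all
  qed
  moreover have "2 * l u + 2 * l v \<le> real n - 1" using l by simp
  \<comment> \<open>This is \<open>(2 * n - 4) - 1 - (n - 1)\<close>.\<close>
  ultimately have "real n - 4 \<le> (\<Sum>i<?K. \<bar>w (2 * i) - w (2 * i + 1)\<bar>)"
    using abs_w by linarith
  then have "2 * real m * (real n - 4) \<le> 2 * real m * (\<Sum>i<?K. \<bar>w (2 * i) - w (2 * i + 1)\<bar>)"
    by (intro mult_left_mono) auto
  then have "2 * real m * (real n - 4) - 2 * real n - 16 * (real m)\<^sup>2
      \<le> (\<Sum>x<N. w x * (real (\<pi> x) - real x))"
    using gain abs_w by linarith
  then show ?thesis using swap uv change by (intro exI[of _ "\<lambda>_. t'"] exI[of _ u] exI[of _ v]) simp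
qed

section \<open>Explicit bounds and their asymptotics\<close>

lemma p_swap_mono: "p_swap n p t \<theta> \<Longrightarrow> p \<le> q \<Longrightarrow> p_swap n q t \<theta>"
  by (fastforce simp: p_swap_def)

lemma max_swap_difference_lower:
  assumes lab: "edge_labeling n t" and magic: "almost_supermagic n a t" and n: "n \<ge> 4" and p: "p \<ge> 1"
  shows "p * real n - (\<bar>a\<bar> + 6 * real n + 6 * p + 4 * p\<^sup>2) < max_swap_difference p t n"
proof -
  \<comment> \<open>The largest \<open>m\<close> with \<open>2 * m + 1 \<le> p\<close>; rounding
    loses less than 2 in \<open>2 * m\<close>.\<close>
  define m where "m = nat \<lfloor>(p - 1) / 2\<rfloor>"
  have "real m = of_int \<lfloor>(p - 1) / 2\<rfloor>" using p by (simp add: m_def)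
  then have m: "2 * real m + 1 \<le> p" "p - 3 \<le> 2 * real m"
    using floor_correct[of "(p - 1) / 2"] by (simp_all add: field_simps)
  obtain \<theta> u v where \<theta>: "p_swap n (2 * real m + 1) t \<theta>" and uv: "u \<in> {1..n}" "v \<in> {1..n}" "u \<noteq> v"
    and gain: "(real (vertex_sum n (\<theta> t) u) - real (vertex_sum n (\<theta> t) v))
      - (real (vertex_sum n t u) - real (vertex_sum n t v))
    \<ge> 2 * real m * (real n - 4) - 2 * real n - 16 * (real m)\<^sup>2"
    using exists_swap_increasing_difference[OF lab, of m] n by auto
  let ?d = "real (vertex_sum n (\<theta> t) u) - real (vertex_sum n (\<theta> t) v)"
  have "\<bar>?d\<bar> \<in> swap_differences p t n"
    using p_swap_mono[OF \<theta> m(1)] uv unfolding swap_differences_def by blast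
  then have "?d \<le> max_swap_difference p t n"
    unfolding max_swap_difference_def using Max_ge[OF finite_swap_differences] by fastforce
  moreover have "(p - 3) * (real n - 4) \<le> 2 * real m * (real n - 4)"
    using m n by (intro mult_right_mono) auto
  \<comment> \<open>This turns the end loss \<open>16 * m^2\<close> into at most
    \<open>4 * p^2\<close>.\<close>
  moreover have "(2 * real m)\<^sup>2 \<le> p\<^sup>2" using m by (intro power_mono) auto
  moreover have "\<bar>real (vertex_sum n t u) - real (vertex_sum n t v)\<bar> \<le> a"
    using magic uv by (simp add: almost_supermagic_def)
  ultimately show ?thesis using gain n p by (simp add: algebra_simps power_mult_distrib)
qed

lemma max_swap_difference_upper:
  assumes lab: "edge_labeling n t" and magic: "almost_supermagic n a t" and n: "n \<ge> 2" and p: "p > 0"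
  shows "max_swap_difference p t n < 2 * p * real n + \<bar>a\<bar>"
  unfolding max_swap_difference_def
proof (subst Max_less_iff[OF finite_swap_differences])
  show "swap_differences p t n \<noteq> {}" using swap_differences_nonempty[OF lab n] p by simp
  show "\<forall>x\<in>swap_differences p t n. x < 2 * p * real n + \<bar>a\<bar>"
  proof
    fix x assume "x \<in> swap_differences p t n"
    then obtain \<theta> u v where x: "x = \<bar>real (vertex_sum n (\<theta> t) u) - real (vertex_sum n (\<theta> t) v)\<bar>"
      and \<theta>: "p_swap n p t \<theta>" and uv: "u \<in> {1..n}" "v \<in> {1..n}"
      unfolding swap_differences_def by blast
    \<comment> \<open>A vertex has \<open>n - 1\<close> edges; the remaining \<open>- p\<close>,
      taken at both vertices, makes the final inequality strict.\<close>
    have near: "\<bar>real (vertex_sum n t z) - real (vertex_sum n (\<theta> t) z)\<bar> \<le> p * real n - p"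
      if z: "z \<in> {1..n}" for z
    proof -
      have "\<bar>real (vertex_sum n t z) - real (vertex_sum n (\<theta> t) z)\<bar>
          = \<bar>\<Sum>e\<in>incident_edges n z. real (t e) - real (\<theta> t e)\<bar>"
        by (simp add: vertex_sum_def sum_subtractf)
      also have "\<dots> \<le> (\<Sum>e\<in>incident_edges n z. \<bar>real (t e) - real (\<theta> t e)\<bar>)" by (rule sum_abs)
      also have "\<dots> \<le> (\<Sum>e\<in>incident_edges n z. p)"
        using \<theta> by (intro sum_mono) (auto simp: p_swap_def incident_edges_def)
      also have "\<dots> = p * real n - p"
        using n by (simp add: card_incident_edges[OF z] of_nat_diff algebra_simps)
      finally show ?thesis .
    qed
    have "\<bar>real (vertex_sum n t u) - real (vertex_sum n t v)\<bar> \<le> a"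
      using magic uv by (simp add: almost_supermagic_def)
    then show "x < 2 * p * real n + \<bar>a\<bar>"
      using near[OF uv(1)] near[OF uv(2)] p unfolding x by linarith
  qed
qed

text \<open>The errors \<open>f\<close> and \<open>g\<close> are read off from the explicit bounds.
  Growth of \<open>p\<close> to infinity makes \<open>n\<close>, and with it
  \<open>\<alpha>\<close>, negligible against \<open>p * n\<close>; \<open>p = o(n)\<close> does the
  same for \<open>p^2\<close>.\<close>

theorem theorem4p4:
  fixes \<alpha> p :: "nat \<Rightarrow> real" and t :: "nat \<Rightarrow> nat set \<Rightarrow> nat"
  assumes "\<alpha> \<in> O(\<lambda>n. real n)"
    and "admissible p"
    and "\<And>n. edge_labeling n (t n)"
    and "\<And>n. almost_supermagic n (\<alpha> n) (t n)"
  shows "\<exists>f g. f \<in> o(\<lambda>n. p n * real n) \<and> g \<in> o(\<lambda>n. p n * real n) \<and>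
    (\<forall>\<^sub>F n in sequentially.
       p n * real n + f n < max_swap_difference (p n) (t n) n \<and>
       max_swap_difference (p n) (t n) n < 2 * p n * real n + g n)"
proof -
  have p_small: "p \<in> o(\<lambda>n. real n)" and p_top: "filterlim p at_top sequentially"
    using assms(2) by (auto simp: admissible_def)
  have "(\<lambda>_. 1) \<in> o(p)"
  proof (rule smalloI_tendsto)
    show "((\<lambda>n. 1 / p n) \<longlongrightarrow> 0) sequentially"
      using filterlim_at_top_imp_at_infinity[OF p_top] by (intro tendsto_divide_0[OF tendsto_const])
    show "\<forall>\<^sub>F n in sequentially. p n \<noteq> 0"
      using filterlim_at_top_dense[THEN iffD1, OF p_top, rule_format, of 0] by eventually_elim simp
  qed
  then have n: "(\<lambda>n. real n) \<in> o(\<lambda>n. p n * real n)"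
    using landau_o.small_big_mult[of "\<lambda>_. 1" _ p real real] by simp
  have \<alpha>: "(\<lambda>n. \<bar>\<alpha> n\<bar>) \<in> o(\<lambda>n. p n * real n)"
    using landau_o.big_small_trans[OF assms(1) n] by simp
  have p2: "(\<lambda>n. (p n)\<^sup>2) \<in> o(\<lambda>n. p n * real n)"
    using landau_o.big_small_mult[of p _ p p real] p_small by (simp add: power2_eq_square)
  have "p \<in> o(\<lambda>n. p n * real n)"
    using landau_o.small_trans[OF p_small n] .
  then have f: "(\<lambda>n. - (\<bar>\<alpha> n\<bar> + 6 * real n + 6 * p n + 4 * (p n)\<^sup>2)) \<in> o(\<lambda>n. p n * real n)"
    using \<alpha> n p2 by (simp add: sum_in_smallo)
  have "\<forall>\<^sub>F n in sequentially. p n \<ge> 1" using p_top by (simp add: filterlim_at_top)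
  then have "\<forall>\<^sub>F n in sequentially.
      p n * real n + - (\<bar>\<alpha> n\<bar> + 6 * real n + 6 * p n + 4 * (p n)\<^sup>2) < max_swap_difference (p n) (t n) n \<and>
      max_swap_difference (p n) (t n) n < 2 * p n * real n + \<bar>\<alpha> n\<bar>"
    using eventually_ge_at_top[of 4]
  proof eventually_elim
    case (elim n)
    then show ?case
      using max_swap_difference_lower[OF assms(3,4), of n "p n"]
        max_swap_difference_upper[OF assms(3,4), of n "p n"] by linarith
  qed
  then show ?thesis using f \<alpha> by blast
qed

end
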